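(* Let $\lambda>0$, $y_0,\zeta\in\mathbb{R}^n$, $y_\zeta=y_0+\zeta$. Let $\mu_{\lambda,\zeta}=\sum_{i=1}^Nc_{\lambda,\zeta}^i\sigma^i\delta_{w_{\lambda,\zeta}^i}$, with $c_{\lambda,\zeta}^i>0$, $\sigma^i\in\{-1,1\}$ and $w_{\lambda,\zeta}^i\in\overline{R}_{\pi^i}\cap\mathbb{S}^{d-1}$, $\pi^i\in\{0,1\}^n$, for all $i=1,\dots,N$. Let $\eta_{\lambda,\zeta}$ be the dual certificate for $\mu_{\lambda,\zeta}$, and suppose that the vectors $\{K\delta_{w_{\lambda,\zeta}^i}\}_{i=1}^N$ are linearly independent and that $$|\eta_{\lambda,\zeta}(w)|<1\quad\text{for all }w\in\mathbb{S}^{d-1}\setminus\{w_{\lambda,\zeta}^1,\dots,w_{\lambda,\zeta}^N\}.$$ Then $\mu_{\lambda,\zeta}$ is the unique solution of the training problem $(P_\lambda)$.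
   Context: Setting. $d,n$ are positive integers, $x^1,\dots,x^n\in\mathbb{R}^d\setminus\{0\}$ are given data points, and $\sigma(z)=\max\{0,z\}$ is the ReLU function (the $\sigma^i$ are signs). $M(\mathbb{S}^{d-1})$ is the space of finite signed Radon measures on the unit sphere $\mathbb{S}^{d-1}\subset\mathbb{R}^d$, with total variation norm $\|\cdot\|_{\mathrm{TV}}$. $K:M(\mathbb{S}^{d-1})\to\mathbb{R}^n$ is $(K\mu)_j=\int_{\mathbb{S}^{d-1}}\sigma(\langle w,x^j\rangle)\,d\mu(w)$, and $K_*:\mathbb{R}^n\to C(\mathbb{S}^{d-1})$ is $K_*p(w)=\sum_{j=1}^np^j\sigma(\langle w,x^j\rangle)$. Training problem $(P_\lambda)$: minimize $\frac12\|K\mu-y_\zeta\|^2+\lambda\|\mu\|_{\mathrm{TV}}$ over $\mu\in M(\mathbb{S}^{d-1})$. Dual certificate: $\eta_{\lambda,\zeta}$ is the dual certificate for $\mu_{\lambda,\zeta}$ if the optimality conditions hold: $\eta_{\lambda,\zeta}=K_*p_{\lambda,\zeta}$ with $p_{\lambda,\zeta}=-\frac1\lambda(K\mu_{\lambda,\zeta}-y_\zeta)$, and $\eta_{\lambda,\zeta}\in\partial\|\mu_{\lambda,\zeta}\|_{\mathrm{TV}}$, i.e. $\|\eta_{\lambda,\zeta}\|_\infty\le1$ and $\int\eta_{\lambda,\zeta}\,d\mu_{\lambda,\zeta}=\|\mu_{\lambda,\zeta}\|_{\mathrm{TV}}$. For $\pi\in\{0,1\}^n$, $R_\pi$ is the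 open set of $w\in\mathbb{R}^d$ such that for every $j$, $\langle w,x^j\rangle>0$ if $\pi_j=1$ and $\langle w,x^j\rangle<0$ if $\pi_j=0$; $\overline R_\pi$ is its closure. *)

theory Defs
  imports "HOL-Analysis.Analysis"
begin

text \<open>
  A finite signed measure on the measurable space \<open>M\<close> is a countably additive real-valued
  function on \<open>sets M\<close>. Outside \<open>sets M\<close> it is normalised to \<open>0\<close>, so that equality of
  such functions is equality of signed measures.
\<close>

definition signed_measure :: "'a measure \<Rightarrow> ('a set \<Rightarrow> real) \<Rightarrow> bool" where
  "signed_measure M \<mu> \<longleftrightarrow>
     (\<forall>A. A \<notin> sets M \<longrightarrow> \<mu> A = 0) \<and> \<mu> {} = 0 \<and>
     (\<forall>A. range A \<subseteq> sets M \<longrightarrow> disjoint_family A \<longrightarrow>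
        (\<lambda>i::nat. \<mu> (A i)) sums \<mu> (\<Union>i. A i))"

text \<open>The total variation measure, by suprema over finite measurable partitions.\<close>

definition total_variation :: "'a measure \<Rightarrow> ('a set \<Rightarrow> real) \<Rightarrow> 'a measure" where
  "total_variation M \<mu> = measure_of (space M) (sets M)
     (\<lambda>A. SUP P \<in> {P. finite P \<and> P \<subseteq> sets M \<and> disjoint P \<and> \<Union>P = A}.
            \<Sum>B\<in>P. ennreal \<bar>\<mu> B\<bar>)"

definition tv_norm :: "'a measure \<Rightarrow> ('a set \<Rightarrow> real) \<Rightarrow> real" where
  "tv_norm M \<mu> = measure (total_variation M \<mu>) (space M)"

text \<open>Jordan decomposition: the positive and negative parts are half of total variation plus or
  minus \<open>\<mu>\<close>.\<close>

definition pos_variation :: "'a measure \<Rightarrow> ('a set \<Rightarrow> real) \<Rightarrow> 'a measure" where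
  "pos_variation M \<mu> = measure_of (space M) (sets M)
     (\<lambda>A. ennreal ((measure (total_variation M \<mu>) A + \<mu> A) / 2))"

definition neg_variation :: "'a measure \<Rightarrow> ('a set \<Rightarrow> real) \<Rightarrow> 'a measure" where
  "neg_variation M \<mu> = measure_of (space M) (sets M)
     (\<lambda>A. ennreal ((measure (total_variation M \<mu>) A - \<mu> A) / 2))"

definition signed_integral :: "'a measure \<Rightarrow> ('a set \<Rightarrow> real) \<Rightarrow> ('a \<Rightarrow> real) \<Rightarrow> real" where
  "signed_integral M \<mu> f =
     integral\<^sup>L (pos_variation M \<mu>) f - integral\<^sup>L (neg_variation M \<mu>) f"

definition sphere_borel :: "(real^'d) measure" where
  "sphere_borel = restrict_space borel (sphere 0 1)"

text \<open>
  Finite signed Radon measures on the unit sphere. The regularity clause is automatic for finite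
  signed Borel measures on a compact metric space.
\<close>

definition radon_measures :: "((real^'d) set \<Rightarrow> real) set" where
  "radon_measures = {\<mu>. signed_measure sphere_borel \<mu> \<and>
     (\<forall>A\<in>sets sphere_borel. \<forall>e>0. \<exists>C\<subseteq>A. compact C \<and>
        measure (total_variation sphere_borel \<mu>) (A - C) < e)}"

definition dirac :: "real^'d \<Rightarrow> (real^'d) set \<Rightarrow> real" where
  "dirac w A = (if A \<in> sets sphere_borel \<and> w \<in> A then 1 else 0)"

definition relu :: "real \<Rightarrow> real" where
  "relu z = max 0 z"

definition K :: "('n \<Rightarrow> real^'d) \<Rightarrow> ((real^'d) set \<Rightarrow> real) \<Rightarrow> real^'n" where
  "K x \<mu> = (\<chi> j. signed_integral sphere_borel \<mu> (\<lambda>w. relu (w \<bullet> x j)))"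

definition K_star :: "('n::finite \<Rightarrow> real^'d) \<Rightarrow> real^'n \<Rightarrow> real^'d \<Rightarrow> real" where
  "K_star x p w = (\<Sum>j\<in>UNIV. p $ j * relu (w \<bullet> x j))"

definition objective ::
  "('n::finite \<Rightarrow> real^'d) \<Rightarrow> real \<Rightarrow> real^'n \<Rightarrow> ((real^'d) set \<Rightarrow> real) \<Rightarrow> real" where
  "objective x lam y \<mu> = 1 / 2 * (norm (K x \<mu> - y))\<^sup>2 + lam * tv_norm sphere_borel \<mu>"

definition training_solution ::
  "('n::finite \<Rightarrow> real^'d) \<Rightarrow> real \<Rightarrow> real^'n \<Rightarrow> ((real^'d) set \<Rightarrow> real) \<Rightarrow> bool" where
  "training_solution x lam y \<mu> \<longleftrightarrow>
     \<mu> \<in> radon_measures \<and> (\<forall>\<nu>\<in>radon_measures. objective x lam y \<mu> \<le> objective x lam y \<nu>)"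

definition sup_norm :: "(real^'d \<Rightarrow> real) \<Rightarrow> real" where
  "sup_norm f = (SUP w\<in>sphere 0 1. \<bar>f w\<bar>)"

text \<open>
  The subdifferential of the total variation norm, as a subset of the continuous functions on the
  sphere. Functions on the sphere are represented by functions on the whole space whose values off
  the sphere are irrelevant.
\<close>

definition tv_subdifferential :: "((real^'d) set \<Rightarrow> real) \<Rightarrow> (real^'d \<Rightarrow> real) set" where
  "tv_subdifferential \<mu> = {\<eta>. continuous_on (sphere 0 1) \<eta> \<and> sup_norm \<eta> \<le> 1 \<and>
     signed_integral sphere_borel \<mu> \<eta> = tv_norm sphere_borel \<mu>}"

definition dual_certificate ::
  "('n::finite \<Rightarrow> real^'d) \<Rightarrow> real \<Rightarrow> real^'n \<Rightarrow> ((real^'d) set \<Rightarrow> real) \<Rightarrow> (real^'d \<Rightarrow> real) \<Rightarrow> bool" where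
  "dual_certificate x lam y \<mu> \<eta> \<longleftrightarrow>
     (\<forall>w\<in>sphere 0 1. \<eta> w = K_star x (- (1 / lam) *\<^sub>R (K x \<mu> - y)) w) \<and>
     \<eta> \<in> tv_subdifferential \<mu>"

text \<open>Activation patterns in \<open>{0,1}\<^sup>n\<close> are encoded as Boolean functions.\<close>

definition region :: "('n \<Rightarrow> real^'d) \<Rightarrow> ('n \<Rightarrow> bool) \<Rightarrow> (real^'d) set" where
  "region x \<pi> = {w. \<forall>j. if \<pi> j then w \<bullet> x j > 0 else w \<bullet> x j < 0}"

end

theory Submission
  imports Defs
begin

text \<open>
  For every signed measure \<open>\<nu>\<close>, expanding the square and using \<open>\<eta> = K\<^sub>* p\<close> shows that the objective
  at \<open>\<nu>\<close> exceeds the one at \<open>\<mu>\<close> by exactly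
  \<open>\<lambda> (\<parallel>\<nu>\<parallel> - \<integral>\<eta> d\<nu>) + \<parallel>K \<nu> - K \<mu>\<parallel>\<^sup>2 / 2\<close>, where both terms are nonnegative as \<open>\<bar>\<eta>\<bar> \<le> 1\<close>.
  If \<open>\<nu>\<close> is another minimizer, both terms vanish. The first then forces \<open>\<nu>\<close> to live on
  \<open>{\<bar>\<eta>\<bar> = 1}\<close>, hence on the atoms of \<open>\<mu>\<close>, and the second together with linear independence
  forces equal weights. Integrals against \<open>\<nu>\<close> are handled through a Hahn decomposition.
\<close>

section \<open>Finite additivity of signed measures\<close>

lemma signed_measure_empty: "signed_measure M \<mu> \<Longrightarrow> \<mu> {} = 0"
  by (simp add: signed_measure_def)

lemma signed_measure_sums:
  "signed_measure M \<mu> \<Longrightarrow> range A \<subseteq> sets M \<Longrightarrow> disjoint_family A \<Longrightarrow>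
    (\<lambda>i::nat. \<mu> (A i)) sums \<mu> (\<Union>i. A i)"
  by (simp add: signed_measure_def)

lemma signed_measure_Un:
  assumes "signed_measure M \<mu>" "A \<in> sets M" "B \<in> sets M" "A \<inter> B = {}"
  shows "\<mu> (A \<union> B) = \<mu> A + \<mu> B"
proof -
  have "disjoint_family (binaryset A B)"
    using assms(4) by (auto simp: disjoint_family_on_def binaryset_def)
  then have "(\<lambda>i. \<mu> (binaryset A B i)) sums \<mu> (\<Union>i. binaryset A B i)"
    using assms by (intro signed_measure_sums[OF assms(1)]) (auto simp: range_binaryset_eq)
  moreover have "(\<lambda>i. \<mu> (binaryset A B i)) sums (\<mu> A + \<mu> B)"
    using signed_measure_empty[OF assms(1)] by (rule binaryset_sums)
  ultimately show ?thesis
    by (simp add: UN_binaryset_eq sums_unique2)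
qed

lemma signed_measure_split:
  assumes "signed_measure M \<mu>" "A \<in> sets M" "P \<in> sets M"
  shows "\<mu> A = \<mu> (A \<inter> P) + \<mu> (A - P)"
  using signed_measure_Un[OF assms(1), of "A \<inter> P" "A - P"] assms by (auto simp: Int_Diff_Un)

lemma signed_measure_Union:
  assumes \<mu>: "signed_measure M \<mu>" and "finite F" "F \<subseteq> sets M" "disjoint F"
  shows "\<mu> (\<Union>F) = (\<Sum>B\<in>F. \<mu> B)"
  using assms(2-)
proof (induction F rule: finite_induct)
  case empty
  then show ?case using signed_measure_empty[OF \<mu>] by simp
next
  case (insert B F)
  have "B \<inter> \<Union>F = {}"
    using insert.prems insert.hyps by (auto simp: disjoint_def)
  moreover have "\<Union>F \<in> sets M"
    using insert by (intro sets.finite_Union) auto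
  moreover have "disjoint F"
    using insert.prems by (auto simp: disjoint_def)
  ultimately show ?case
    using insert signed_measure_Un[OF \<mu>, of B "\<Union>F"] by simp
qed

section \<open>Hahn decomposition\<close>

definition positive_set :: "'a measure \<Rightarrow> ('a set \<Rightarrow> real) \<Rightarrow> 'a set \<Rightarrow> bool" where
  "positive_set M \<mu> P \<longleftrightarrow> P \<in> sets M \<and> (\<forall>A\<in>sets M. A \<subseteq> P \<longrightarrow> 0 \<le> \<mu> A)"

text \<open>Truncating at \<open>-1\<close> allows for \<open>\<mu>\<close> not yet being known to be bounded below.\<close>

lemma signed_measure_half_minimal_subset:
  assumes \<mu>: "signed_measure M \<mu>" and A: "A \<in> sets M"
  shows "\<exists>B\<in>sets M. B \<subseteq> A \<and> \<mu> B \<le> 0 \<and> (\<forall>C\<in>sets M. C \<subseteq> A \<longrightarrow> \<mu> B \<le> max (\<mu> C / 2) (- 1))"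
proof (cases "\<exists>B\<in>sets M. B \<subseteq> A \<and> \<mu> B \<le> - 1")
  case True
  then obtain B where "B \<in> sets M" "B \<subseteq> A" "\<mu> B \<le> -1" by blast
  \<comment> \<open>The right-hand side never falls below -1, so this \<open>B\<close> meets all the
    bounds at once.\<close>
  then show ?thesis by (intro bexI[of _ B]) (auto simp: le_max_iff_disj)
next
  case False
  define V where "V = \<mu> ` {C \<in> sets M. C \<subseteq> A}"
  have bdd: "bdd_below V"
    using False by (intro bdd_belowI[of _ "-1"]) (force simp: V_def)
  have V0: "0 \<in> V"
    using signed_measure_empty[OF \<mu>] by (force simp: V_def)
  have lower: "Inf V \<le> \<mu> C" if "C \<in> sets M" "C \<subseteq> A" for C
    using that by (intro cInf_lower bdd) (auto simp: V_def)
  show ?thesis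
  proof (cases "Inf V < 0")
    case True
    \<comment> \<open>A negative infimum lies strictly below its half, so some \<open>B\<close> has
      value below \<open>Inf V / 2\<close>, which is at most \<open>\<mu> C / 2\<close> for every
      candidate \<open>C\<close>.\<close>
    then have "Inf V < Inf V / 2" by simp
    then obtain v where "v \<in> V" "v < Inf V / 2"
      using cInf_lessD[of V] V0 by blast
    then obtain B where B: "B \<in> sets M" "B \<subseteq> A" "\<mu> B < Inf V / 2"
      by (auto simp: V_def)
    have "\<mu> B \<le> max (\<mu> C / 2) (- 1)" if "C \<in> sets M" "C \<subseteq> A" for C
      using lower[OF that] B(3) by linarith
    then show ?thesis using B True by (intro bexI[of _ B]) auto
  next
    case False
    \<comment> \<open>No subset has negative value here, so the empty set serves as witness.\<close>
    then have "0 \<le> \<mu> C" if "C \<in> sets M" "C \<subseteq> A" for C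
      using lower[OF that] by linarith
    then show ?thesis
      using signed_measure_empty[OF \<mu>] by (intro bexI[of _ "{}"]) (auto simp: le_max_iff_disj)
  qed
qed

text \<open>Greedy exhaustion: keep removing a subset whose value is, up to a factor 2 and
  truncation at -1, as negative as possible. Removing pieces of nonpositive value cannot lower the
  value of the rest. The pieces are disjoint, so their values are summable and tend to 0; a negative
  subset \<open>C\<close> of the remainder would be a candidate at every stage and keep all these
  values below one fixed negative number.\<close>

lemma signed_measure_positive_subset:
  assumes \<mu>: "signed_measure M \<mu>" and D: "D \<in> sets M"
  obtains P where "positive_set M \<mu> P" "P \<subseteq> D" "\<mu> D \<le> \<mu> P"
proof -
  obtain g where g: "\<And>A. A \<in> sets M \<Longrightarrow> g A \<in> sets M \<and> g A \<subseteq> A \<and> \<mu> (g A) \<le> 0 \<and>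
      (\<forall>C\<in>sets M. C \<subseteq> A \<longrightarrow> \<mu> (g A) \<le> max (\<mu> C / 2) (- 1))"
    using signed_measure_half_minimal_subset[OF \<mu>] by metis
  \<comment> \<open>\<open>A n\<close> is what is left of \<open>D\<close> after \<open>n\<close>
    removals, and \<open>B n\<close> below is the piece removed next.\<close>
  define A where "A = rec_nat D (\<lambda>_ X. X - g X)"
  have A0: "A 0 = D" and AS: "A (Suc n) = A n - g (A n)" for n
    by (simp_all add: A_def)
  have A_sets: "A n \<in> sets M" for n
    by (induction n) (use D g in \<open>auto simp: A0 AS\<close>)
  have A_anti: "A n \<subseteq> A m" if "m \<le> n" for m n
    using that by (induction n rule: dec_induct) (auto simp: AS)
  define B where "B n = g (A n)" for n
  have B: "B n \<in> sets M" "B n \<subseteq> A n" "\<mu> (B n) \<le> 0"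
    "\<And>C. C \<in> sets M \<Longrightarrow> C \<subseteq> A n \<Longrightarrow> \<mu> (B n) \<le> max (\<mu> C / 2) (- 1)" for n
    using g[OF A_sets[of n]] by (auto simp: B_def)
  \<comment> \<open>\<open>B n\<close> lies inside \<open>A (Suc m)\<close>, which has already lost
    \<open>B m\<close>.\<close>
  have "B m \<inter> B n = {}" if "m < n" for m n
    using A_anti[of "Suc m" n] B(2)[of n] that by (auto simp: AS B_def)
  then have "disjoint_family B"
    unfolding disjoint_family_on_def by (metis Int_commute linorder_neqE_nat)
  then have sums: "(\<lambda>n. \<mu> (B n)) sums \<mu> (\<Union>n. B n)"
    using B(1) by (intro signed_measure_sums[OF \<mu>]) auto
  define P where "P = D - (\<Union>n. B n)"
  have UB: "(\<Union>n. B n) \<in> sets M" using B(1) by auto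
  have P_sets: "P \<in> sets M" using D UB by (auto simp: P_def)
  have UB_sub: "(\<Union>n. B n) \<subseteq> D" using A_anti[of 0] B(2) by (fastforce simp: A0)
  have P_sub: "P \<subseteq> A n" for n
    by (induction n) (auto simp: P_def A0 AS B_def)
  have "0 \<le> \<mu> C" if C: "C \<in> sets M" "C \<subseteq> P" for C
  proof (rule ccontr)
    assume "\<not> 0 \<le> \<mu> C"
    then have "max (\<mu> C / 2) (- 1) < 0" by simp
    moreover have "(\<lambda>n. \<mu> (B n)) \<longlonglongrightarrow> 0"
      using sums by (simp add: sums_iff summable_LIMSEQ_zero)
    moreover have "\<mu> (B n) \<le> max (\<mu> C / 2) (- 1)" for n
      using B(4) C P_sub by blast
    ultimately show False
      using LIMSEQ_le_const2[of "\<lambda>n. \<mu> (B n)" 0] by (meson linorder_not_le)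
  qed
  then have "positive_set M \<mu> P" using P_sets by (simp add: positive_set_def)
  moreover have "\<mu> D \<le> \<mu> P"
  proof -
    have "\<mu> (\<Union>n. B n) \<le> 0"
      using B(3) sums sums_le[OF _ sums sums_zero] by blast
    moreover have "D \<inter> (\<Union>n. B n) = (\<Union>n. B n)" using UB_sub by blast
    ultimately show ?thesis
      using signed_measure_split[OF \<mu> D UB] by (simp add: P_def)
  qed
  ultimately show ?thesis using that by (auto simp: P_def)
qed

lemma positive_set_mono:
  assumes "signed_measure M \<mu>" "positive_set M \<mu> P" "A \<in> sets M" "A \<subseteq> P"
  shows "\<mu> A \<le> \<mu> P"
proof -
  have "\<mu> P = \<mu> A + \<mu> (P - A)"
    using signed_measure_split[OF assms(1), of P A] assms
    by (simp add: positive_set_def Int_absorb1)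
  moreover have "0 \<le> \<mu> (P - A)"
    using assms by (auto simp: positive_set_def)
  ultimately show ?thesis by simp
qed

text \<open>A measurable subset of the union is cut along the disjoint sets
  \<open>disjointed P n\<close>; each piece lies in a single \<open>P n\<close>, so its value is a
  series of nonnegative terms.\<close>

lemma positive_set_UN:
  assumes \<mu>: "signed_measure M \<mu>" and P: "\<And>n::nat. positive_set M \<mu> (P n)"
  shows "positive_set M \<mu> (\<Union>n. P n)"
  unfolding positive_set_def
proof (intro conjI ballI impI)
  have P_sets: "P n \<in> sets M" for n using P by (simp add: positive_set_def)
  then show "(\<Union>n. P n) \<in> sets M" by auto
  fix A assume A: "A \<in> sets M" "A \<subseteq> (\<Union>n. P n)"
  have dP: "disjointed P n \<in> sets M" for n
    using sets.range_disjointed_sets[of P M] P_sets by blast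
  have "(\<lambda>n. \<mu> (A \<inter> disjointed P n)) sums \<mu> (\<Union>n. A \<inter> disjointed P n)"
    using A(1) dP disjoint_family_disjointed[of P]
    by (intro signed_measure_sums[OF \<mu>]) (auto simp: disjoint_family_on_def)
  moreover have "(\<Union>n. A \<inter> disjointed P n) = A"
    using A(2) UN_disjointed_eq[of P] by blast
  moreover have "0 \<le> \<mu> (A \<inter> disjointed P n)" for n
    using P[of n] A(1) dP[of n] disjointed_subset[of P n]
    unfolding positive_set_def by (meson le_infI2 sets.Int)
  ultimately show "0 \<le> \<mu> A"
    using sums_le[OF _ sums_zero, of "\<lambda>n. \<mu> (A \<inter> disjointed P n)"] by simp
qed

text \<open>Take a positive set \<open>P\<close> of maximal value, obtained as the union of a
  maximizing sequence. If some \<open>A\<close> off \<open>P\<close> had positive value, it would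
  contain a positive set \<open>Q\<close> of at least that value, and \<open>P \<union> Q\<close>
  would beat \<open>P\<close>.\<close>

lemma signed_measure_Hahn:
  assumes \<mu>: "signed_measure M \<mu>"
  obtains P where "positive_set M \<mu> P" "\<And>A. A \<in> sets M \<Longrightarrow> A \<inter> P = {} \<Longrightarrow> \<mu> A \<le> 0"
proof -
  define V where "V = \<mu> ` {P. positive_set M \<mu> P}"
  have V_ne: "V \<noteq> {}"
  proof -
    have "positive_set M \<mu> {}"
      using signed_measure_empty[OF \<mu>] by (auto simp: positive_set_def)
    then show ?thesis by (auto simp: V_def)
  qed
  \<comment> \<open>Used twice: to show that \<open>V\<close> is bounded above, and then that its
    supremum is attained. The dominating set is the union.\<close>
  have V_union: "\<exists>P. positive_set M \<mu> P \<and> (\<forall>n. v n \<le> \<mu> P)" if "\<And>n::nat. v n \<in> V" for v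
  proof -
    have "\<forall>n. \<exists>Q. positive_set M \<mu> Q \<and> v n = \<mu> Q"
      using that unfolding V_def by blast
    then obtain Q where Q: "\<And>n. positive_set M \<mu> (Q n)" "\<And>n. v n = \<mu> (Q n)"
      by metis
    have "positive_set M \<mu> (\<Union>n. Q n)" using positive_set_UN[OF \<mu> Q(1)] .
    moreover from this have "v n \<le> \<mu> (\<Union>n. Q n)" for n
      unfolding Q(2) using Q(1) by (intro positive_set_mono[OF \<mu>]) (auto simp: positive_set_def)
    ultimately show ?thesis by blast
  qed
  have bdd: "bdd_above V"
  proof (rule ccontr)
    assume "\<not> bdd_above V"
    then have "\<forall>n::nat. \<exists>v\<in>V. real n < v"
      unfolding bdd_above_def by (meson linorder_not_le)
    then obtain v where v: "\<And>n. v n \<in> V" "\<And>n. real n < v n" by metis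
    obtain P where "\<And>n. v n \<le> \<mu> P" using V_union v(1) by blast
    then have "real n < \<mu> P" for n using v(2) less_le_trans by blast
    then show False using reals_Archimedean2 less_asym by blast
  qed
  have "\<exists>v\<in>V. Sup V - 1 / Suc n < v" for n
    by (subst less_cSup_iff[OF V_ne bdd, symmetric]) simp
  then obtain v where v: "\<And>n. v n \<in> V" "\<And>n. Sup V - 1 / Suc n < v n" by metis
  obtain P where P: "positive_set M \<mu> P" "\<And>n. v n \<le> \<mu> P" using V_union v(1) by blast
  have "Sup V \<le> \<mu> P"
  proof (rule field_le_epsilon)
    fix e :: real assume "e > 0"
    then obtain n where "1 / Suc n < e" using nat_approx_posE by blast
    then show "Sup V \<le> \<mu> P + e" using v(2)[of n] P(2)[of n] by linarith
  qed
  then have max: "\<mu> Q \<le> \<mu> P" if "positive_set M \<mu> Q" for Q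
    using cSup_upper[OF _ bdd, of "\<mu> Q"] that by (force simp: V_def)
  have "\<mu> A \<le> 0" if A: "A \<in> sets M" "A \<inter> P = {}" for A
  proof -
    obtain Q where Q: "positive_set M \<mu> Q" "Q \<subseteq> A" "\<mu> A \<le> \<mu> Q"
      using signed_measure_positive_subset[OF \<mu> A(1)] by blast
    \<comment> \<open>The sequence P, Q, Q, ... brings the binary union into the form of
      \<open>positive_set_UN\<close>.\<close>
    have "positive_set M \<mu> (\<Union>n::nat. if n = 0 then P else Q)"
      using P(1) Q(1) by (intro positive_set_UN[OF \<mu>]) auto
    moreover have "(\<Union>n::nat. if n = 0 then P else Q) = P \<union> Q"
      by (auto split: if_splits)
    moreover have "\<mu> (P \<union> Q) = \<mu> P + \<mu> Q"
      using P(1) Q A(2) by (intro signed_measure_Un[OF \<mu>]) (auto simp: positive_set_def)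
    ultimately show ?thesis using max[of "P \<union> Q"] Q(3) by simp
  qed
  then show ?thesis using that P(1) by blast
qed

section \<open>Total variation and Jordan decomposition\<close>

text \<open>\<open>measure_of\<close> retains the given set function only if it is a measure and
  falls back to zero otherwise. This check is made here once for the total variation and both of its
  parts; \<open>\<nu>\<close> is a real-valued closed form of the defining \<open>f\<close>, with
  which it agrees on measurable sets.\<close>

lemma measure_of_nonneg:
  fixes \<nu> :: "'a set \<Rightarrow> real"
  assumes f: "\<And>A. A \<in> sets M \<Longrightarrow> f A = ennreal (\<nu> A)"
    and nonneg: "\<And>A. A \<in> sets M \<Longrightarrow> 0 \<le> \<nu> A" and empty: "\<nu> {} = 0"
    and sums: "\<And>A. range A \<subseteq> sets M \<Longrightarrow> disjoint_family A \<Longrightarrow>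
      (\<lambda>i::nat. \<nu> (A i)) sums \<nu> (\<Union>i. A i)"
  shows "finite_measure (measure_of (space M) (sets M) f)"
    and "\<And>A. A \<in> sets M \<Longrightarrow> measure (measure_of (space M) (sets M) f) A = \<nu> A"
proof -
  let ?N = "measure_of (space M) (sets M) f"
  have ca: "countably_additive (sets M) f"
    unfolding countably_additive_def
  proof (intro allI impI)
    fix A :: "nat \<Rightarrow> 'a set"
    assume A: "range A \<subseteq> sets M" "disjoint_family A" "\<Union> (range A) \<in> sets M"
    have s: "(\<lambda>i. \<nu> (A i)) sums \<nu> (\<Union>i. A i)" using sums[OF A(1,2)] .
    have "(\<Sum>i. f (A i)) = (\<Sum>i. ennreal (\<nu> (A i)))"
      using A(1) f by (intro suminf_cong) auto
    also have "\<dots> = ennreal (\<Sum>i. \<nu> (A i))"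
      using s A(1) nonneg by (intro suminf_ennreal2) (auto simp: sums_iff)
    also have "\<dots> = f (\<Union> (range A))"
      using s f[OF A(3)] by (simp add: sums_iff)
    finally show "(\<Sum>i. f (A i)) = f (\<Union> (range A))" .
  qed
  have pos: "positive (sets M) f"
    using f[of "{}"] empty by (simp add: positive_def)
  have em: "emeasure ?N A = ennreal (\<nu> A)" if "A \<in> sets M" for A
    using emeasure_measure_of_sigma[OF sets.sigma_algebra_axioms pos ca that] f[OF that] by simp
  then show "measure ?N A = \<nu> A" if "A \<in> sets M" for A
    using that nonneg by (simp add: measure_def)
  show "finite_measure ?N"
    using em[of "space M"] sets.space_closed[of M]
    by (intro finite_measureI) (simp add: space_measure_of)
qed

text \<open>On each block \<open>B\<close> of a partition, \<open>\<mu> (B \<inter> P)\<close> is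
  nonnegative and \<open>\<mu> (B - P)\<close> nonpositive, so their difference bounds the absolute
  value of their sum; adding up the blocks gives the upper bound. The partition into
  \<open>A \<inter> P\<close> and \<open>A - P\<close> attains it.\<close>

lemma total_variation_eq_SUP:
  assumes \<mu>: "signed_measure M \<mu>" and A: "A \<in> sets M" and P: "positive_set M \<mu> P"
    and N: "\<And>A. A \<in> sets M \<Longrightarrow> A \<inter> P = {} \<Longrightarrow> \<mu> A \<le> 0"
  shows "(SUP F \<in> {F. finite F \<and> F \<subseteq> sets M \<and> disjoint F \<and> \<Union>F = A}. \<Sum>B\<in>F. ennreal \<bar>\<mu> B\<bar>)
    = ennreal (\<mu> (A \<inter> P) - \<mu> (A - P))"
proof (rule antisym)
  have Ps: "P \<in> sets M" using P by (simp add: positive_set_def)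
  show "(SUP F \<in> {F. finite F \<and> F \<subseteq> sets M \<and> disjoint F \<and> \<Union>F = A}. \<Sum>B\<in>F. ennreal \<bar>\<mu> B\<bar>)
    \<le> ennreal (\<mu> (A \<inter> P) - \<mu> (A - P))"
  proof (rule SUP_least)
    fix F assume "F \<in> {F. finite F \<and> F \<subseteq> sets M \<and> disjoint F \<and> \<Union>F = A}"
    then have F: "finite F" "F \<subseteq> sets M" "disjoint F" "\<Union>F = A" by auto
    have split: "\<mu> (A \<inter> Q) = (\<Sum>B\<in>F. \<mu> (B \<inter> Q))" if Q: "Q \<in> sets M" for Q
    proof -
      have "\<mu> (\<Union>((\<lambda>B. B \<inter> Q) ` F)) = (\<Sum>C\<in>(\<lambda>B. B \<inter> Q) ` F. \<mu> C)"
        using F Q by (intro signed_measure_Union[OF \<mu>]) (auto simp: disjoint_def)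
      also have "\<dots> = (\<Sum>B\<in>F. \<mu> (B \<inter> Q))"
      \<comment> \<open>Different blocks may have the same trace on \<open>Q\<close>, but by
        disjointness that trace is empty and contributes 0.\<close>
      proof (subst sum.reindex_nontrivial[OF F(1)])
        fix B C assume "B \<in> F" "C \<in> F" "B \<noteq> C" "B \<inter> Q = C \<inter> Q"
        then have "B \<inter> Q = {}" using F(3) by (auto simp: disjoint_def)
        then show "\<mu> (B \<inter> Q) = 0" using signed_measure_empty[OF \<mu>] by simp
      qed simp
      also have "\<Union>((\<lambda>B. B \<inter> Q) ` F) = A \<inter> Q" using F(4) by blast
      finally show ?thesis .
    qed
    have sub: "B \<subseteq> space M" if "B \<in> sets M" for B using sets.sets_into_space[OF that] .
    \<comment> \<open>Written as an intersection, the difference also falls under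
      \<open>split\<close>.\<close>
    have diff: "B - P = B \<inter> (space M - P)" if "B \<in> sets M" for B using sub[OF that] by blast
    have "(\<Sum>B\<in>F. \<bar>\<mu> B\<bar>) \<le> (\<Sum>B\<in>F. \<mu> (B \<inter> P) - \<mu> (B - P))"
    proof (rule sum_mono)
      fix B assume "B \<in> F"
      then have B: "B \<in> sets M" using F by blast
      have "0 \<le> \<mu> (B \<inter> P)" using P B Ps by (auto simp: positive_set_def)
      moreover have "\<mu> (B - P) \<le> 0" using B Ps by (intro N) auto
      ultimately show "\<bar>\<mu> B\<bar> \<le> \<mu> (B \<inter> P) - \<mu> (B - P)"
        using signed_measure_split[OF \<mu> B Ps] by linarith
    qed
    also have "\<dots> = \<mu> (A \<inter> P) - \<mu> (A - P)"
    proof -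
      have "(\<Sum>B\<in>F. \<mu> (B - P)) = (\<Sum>B\<in>F. \<mu> (B \<inter> (space M - P)))"
        using F(2) diff by (intro sum.cong) (blast intro: arg_cong[of _ _ \<mu>])+
      also have "\<dots> = \<mu> (A - P)"
        unfolding diff[OF A] by (rule split[symmetric]) (use Ps in auto)
      finally show ?thesis by (simp only: sum_subtractf split[OF Ps])
    qed
    finally show "(\<Sum>B\<in>F. ennreal \<bar>\<mu> B\<bar>) \<le> ennreal (\<mu> (A \<inter> P) - \<mu> (A - P))"
      by (simp add: sum_ennreal ennreal_leI)
  qed
  let ?F = "{A \<inter> P, A - P}"
  have pos: "0 \<le> \<mu> (A \<inter> P)" using P A Ps by (auto simp: positive_set_def)
  have neg: "\<mu> (A - P) \<le> 0" using A Ps by (intro N) auto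
  have "(\<Sum>B\<in>?F. ennreal \<bar>\<mu> B\<bar>) = ennreal (\<mu> (A \<inter> P) - \<mu> (A - P))"
  \<comment> \<open>If the two blocks coincide, \<open>?F\<close> has just one element; both blocks
    are then empty.\<close>
  proof (cases "A \<inter> P = A - P")
    case True
    then have empty: "A \<inter> P = {}" "A - P = {}" by blast+
    show ?thesis unfolding empty using signed_measure_empty[OF \<mu>] by simp
  next
    case False
    then show ?thesis using pos neg by (simp add: ennreal_plus[symmetric] del: ennreal_plus)
  qed
  moreover have "?F \<in> {F. finite F \<and> F \<subseteq> sets M \<and> disjoint F \<and> \<Union>F = A}"
    using A Ps by (simp add: pairwise_insert disjnt_def Int_Diff_Un) blast
  ultimately show "ennreal (\<mu> (A \<inter> P) - \<mu> (A - P)) \<le>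
    (SUP F \<in> {F. finite F \<and> F \<subseteq> sets M \<and> disjoint F \<and> \<Union>F = A}. \<Sum>B\<in>F. ennreal \<bar>\<mu> B\<bar>)"
    by (intro SUP_upper2[of ?F]) (simp_all only: order_refl)
qed

lemma sets_variation [simp]:
  "sets (pos_variation M \<mu>) = sets M" "sets (neg_variation M \<mu>) = sets M"
  "space (pos_variation M \<mu>) = space M" "space (neg_variation M \<mu>) = space M"
  by (simp_all add: pos_variation_def neg_variation_def)

text \<open>A Hahn set \<open>P\<close> gives the total variation in closed form, and the two
  variations become the restrictions of \<open>\<mu>\<close> to \<open>P\<close> and of
  \<open>- \<mu>\<close> to its complement. All later facts about integrals against a signed measure
  rest on this description.\<close>

lemma signed_measure_Jordan:
  assumes \<mu>: "signed_measure M \<mu>"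
  obtains P where "P \<in> sets M"
    "finite_measure (pos_variation M \<mu>)" "finite_measure (neg_variation M \<mu>)"
    "\<And>A. A \<in> sets M \<Longrightarrow> measure (pos_variation M \<mu>) A = \<mu> (A \<inter> P)"
    "\<And>A. A \<in> sets M \<Longrightarrow> measure (neg_variation M \<mu>) A = - \<mu> (A - P)"
    "\<And>A. A \<in> sets M \<Longrightarrow> measure (total_variation M \<mu>) A = \<mu> (A \<inter> P) - \<mu> (A - P)"
proof -
  obtain P where P: "positive_set M \<mu> P"
    and N: "\<And>A. A \<in> sets M \<Longrightarrow> A \<inter> P = {} \<Longrightarrow> \<mu> A \<le> 0"
    using signed_measure_Hahn[OF \<mu>] by blast
  have Ps: "P \<in> sets M" using P by (simp add: positive_set_def)
  have pos: "0 \<le> \<mu> (A \<inter> P)" and neg: "\<mu> (A - P) \<le> 0" if "A \<in> sets M" for A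
    using P that Ps N[of "A - P"] by (auto simp: positive_set_def)
  have sums_Int: "(\<lambda>i. \<mu> (A i \<inter> P)) sums \<mu> ((\<Union>i. A i) \<inter> P)"
    and sums_Diff: "(\<lambda>i. \<mu> (A i - P)) sums \<mu> ((\<Union>i. A i) - P)"
    if A: "range A \<subseteq> sets M" "disjoint_family A" for A :: "nat \<Rightarrow> _"
  proof -
    have "(\<lambda>i. \<mu> (A i \<inter> P)) sums \<mu> (\<Union>i. A i \<inter> P)"
      using A Ps by (intro signed_measure_sums[OF \<mu>]) (auto simp: disjoint_family_on_def)
    then show "(\<lambda>i. \<mu> (A i \<inter> P)) sums \<mu> ((\<Union>i. A i) \<inter> P)" by simp
    have "(\<lambda>i. \<mu> (A i - P)) sums \<mu> (\<Union>i. A i - P)"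
      using A Ps by (intro signed_measure_sums[OF \<mu>]) (auto simp: disjoint_family_on_def)
    then show "(\<lambda>i. \<mu> (A i - P)) sums \<mu> ((\<Union>i. A i) - P)" by simp
  qed
  have tv: "measure (total_variation M \<mu>) A = \<mu> (A \<inter> P) - \<mu> (A - P)" if "A \<in> sets M" for A
    unfolding total_variation_def
  proof (rule measure_of_nonneg(2)[where \<nu> = "\<lambda>A. \<mu> (A \<inter> P) - \<mu> (A - P)" and M = M])
    show "0 \<le> \<mu> (A \<inter> P) - \<mu> (A - P)" if "A \<in> sets M" for A
      using pos[OF that] neg[OF that] by linarith
    show "\<mu> ({} \<inter> P) - \<mu> ({} - P) = 0" by simp
  next
    fix B assume "B \<in> sets M"
    then show "(SUP F \<in> {F. finite F \<and> F \<subseteq> sets M \<and> disjoint F \<and> \<Union>F = B}. \<Sum>C\<in>F. ennreal \<bar>\<mu> C\<bar>)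
      = ennreal (\<mu> (B \<inter> P) - \<mu> (B - P))"
      using total_variation_eq_SUP[OF \<mu> _ P N] by blast
  next
    fix B :: "nat \<Rightarrow> 'a set" assume "range B \<subseteq> sets M" "disjoint_family B"
    then show "(\<lambda>i. \<mu> (B i \<inter> P) - \<mu> (B i - P)) sums (\<mu> ((\<Union>i. B i) \<inter> P) - \<mu> ((\<Union>i. B i) - P))"
      by (intro sums_diff sums_Int sums_Diff)
  qed (fact that)
  \<comment> \<open>Since \<open>\<mu> A = \<mu> (A \<inter> P) + \<mu> (A - P)\<close>, adding it
    to or subtracting it from the total variation cancels one part and doubles the other.\<close>
  have half_pos: "ennreal ((measure (total_variation M \<mu>) A + \<mu> A) / 2) = ennreal (\<mu> (A \<inter> P))"
    and half_neg: "ennreal ((measure (total_variation M \<mu>) A - \<mu> A) / 2) = ennreal (- \<mu> (A - P))"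
    if "A \<in> sets M" for A
    using tv[OF that] signed_measure_split[OF \<mu> that Ps] by simp_all
  have empty: "\<mu> ({} \<inter> P) = 0" "- \<mu> ({} - P) = 0"
    using signed_measure_empty[OF \<mu>] by simp_all
  have neg': "0 \<le> - \<mu> (A - P)" if "A \<in> sets M" for A
    using neg[OF that] by simp
  have p: "finite_measure (pos_variation M \<mu>)"
    "\<And>A. A \<in> sets M \<Longrightarrow> measure (pos_variation M \<mu>) A = \<mu> (A \<inter> P)"
    unfolding pos_variation_def
    by (intro measure_of_nonneg[where \<nu> = "\<lambda>A. \<mu> (A \<inter> P)"] half_pos pos empty(1) sums_Int; assumption)+
  have n: "finite_measure (neg_variation M \<mu>)"
    "\<And>A. A \<in> sets M \<Longrightarrow> measure (neg_variation M \<mu>) A = - \<mu> (A - P)"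
    unfolding neg_variation_def
    by (intro measure_of_nonneg[where \<nu> = "\<lambda>A. - \<mu> (A - P)"] half_neg neg' empty(2)
        sums_minus[OF sums_Diff]; assumption)+
  show ?thesis by (rule that[OF Ps p(1) n(1) p(2) n(2) tv])
qed

section \<open>Duality between integrals and the total variation norm\<close>

text \<open>The total variation norm is the sum of the masses of both variations, so each mass can
  be absorbed into the integral over its own variation. When \<open>f\<close> takes values in
  [-1, 1], both integrands are nonnegative, which yields the norm inequality and its equality case
  below.\<close>

lemma tv_norm_diff_signed_integral:
  assumes \<mu>: "signed_measure M \<mu>" and f: "f \<in> borel_measurable M"
    and bound: "\<And>x. x \<in> space M \<Longrightarrow> \<bar>f x\<bar> \<le> B"
  shows "tv_norm M \<mu> - signed_integral M \<mu> f =
    (\<integral>x. 1 - f x \<partial>pos_variation M \<mu>) + (\<integral>x. 1 + f x \<partial>neg_variation M \<mu>)"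
proof -
  obtain P where P: "P \<in> sets M"
    and fin: "finite_measure (pos_variation M \<mu>)" "finite_measure (neg_variation M \<mu>)"
    and Jordan: "\<And>A. A \<in> sets M \<Longrightarrow> measure (pos_variation M \<mu>) A = \<mu> (A \<inter> P)"
      "\<And>A. A \<in> sets M \<Longrightarrow> measure (neg_variation M \<mu>) A = - \<mu> (A - P)"
      "\<And>A. A \<in> sets M \<Longrightarrow> measure (total_variation M \<mu>) A = \<mu> (A \<inter> P) - \<mu> (A - P)"
    by (rule signed_measure_Jordan[OF \<mu>]) (rule that)
  have int: "integrable N (\<lambda>_. 1 :: real)" "integrable N f"
    if "finite_measure N" "sets N = sets M" for N
  proof -
    interpret finite_measure N by fact
    show "integrable N (\<lambda>_. 1 :: real)" by simp
    show "integrable N f"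
      using f bound sets_eq_imp_space_eq[OF that(2)]
      by (intro integrable_const_bound[of _ B])
        (auto simp: measurable_cong_sets[OF that(2) refl])
  qed
  show ?thesis
    using Jordan[OF sets.top] int[OF fin(1)] int[OF fin(2)]
    by (simp add: tv_norm_def signed_integral_def)
qed

lemma signed_integral_le_tv_norm:
  assumes "signed_measure M \<mu>" "f \<in> borel_measurable M" "\<And>x. x \<in> space M \<Longrightarrow> \<bar>f x\<bar> \<le> 1"
  shows "signed_integral M \<mu> f \<le> tv_norm M \<mu>"
proof -
  have "0 \<le> (\<integral>x. 1 - f x \<partial>pos_variation M \<mu>)" "0 \<le> (\<integral>x. 1 + f x \<partial>neg_variation M \<mu>)"
    using assms(3) by (force intro: Bochner_Integration.integral_nonneg simp: abs_le_iff)+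
  then show ?thesis using tv_norm_diff_signed_integral[OF assms] by simp
qed

text \<open>Equality makes both nonnegative integrals of \<open>tv_norm_diff_signed_integral\<close>
  vanish, so \<open>f\<close> is 1 almost everywhere for the positive variation and -1 almost
  everywhere for the negative one. Hence \<open>A\<close> is null for both.\<close>

lemma signed_measure_eq_0_if_norming:
  assumes \<mu>: "signed_measure M \<mu>" and f: "f \<in> borel_measurable M"
    and bound: "\<And>x. x \<in> space M \<Longrightarrow> \<bar>f x\<bar> \<le> 1"
    and eq: "signed_integral M \<mu> f = tv_norm M \<mu>"
    and A: "A \<in> sets M" "\<And>x. x \<in> A \<Longrightarrow> \<bar>f x\<bar> < 1"
  shows "\<mu> A = 0"
proof -
  obtain P where P: "P \<in> sets M"
    and fin: "finite_measure (pos_variation M \<mu>)" "finite_measure (neg_variation M \<mu>)"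
    and Jordan: "\<And>A. A \<in> sets M \<Longrightarrow> measure (pos_variation M \<mu>) A = \<mu> (A \<inter> P)"
      "\<And>A. A \<in> sets M \<Longrightarrow> measure (neg_variation M \<mu>) A = - \<mu> (A - P)"
    by (rule signed_measure_Jordan[OF \<mu>]) (rule that)
  \<comment> \<open>Applied with \<open>1 - f\<close> and \<open>1 + f\<close> as \<open>g\<close>;
    both are positive on \<open>A\<close>, and the upper bound 2 provides integrability.\<close>
  have null: "measure N A = 0"
    if "finite_measure N" and N: "sets N = sets M" and g: "g \<in> borel_measurable M"
      "\<And>x. x \<in> space M \<Longrightarrow> 0 \<le> g x \<and> g x \<le> 2" "(\<integral>x. g x \<partial>N) = 0" "\<And>x. x \<in> A \<Longrightarrow> 0 < g x"
    for N and g :: "_ \<Rightarrow> real"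
  proof -
    interpret finite_measure N by fact
    have sp: "space N = space M" using N by (rule sets_eq_imp_space_eq)
    have "g \<in> borel_measurable N" using g(1) by (simp add: measurable_cong_sets[OF N refl])
    then have "integrable N g" using g(2) sp by (intro integrable_const_bound[of _ 2]) auto
    then have "AE x in N. g x = 0"
      using integral_nonneg_eq_0_iff_AE[of N g] g(2,3) sp by auto
    then have "AE x in N. x \<notin> A" by eventually_elim (metis g(4) less_irrefl)
    then have "A \<in> null_sets N" using AE_iff_null_sets[of A N] A(1) N by simp
    then show ?thesis by (simp add: measure_def null_sets_def)
  qed
  have ge: "0 \<le> (\<integral>x. 1 - f x \<partial>pos_variation M \<mu>)" "0 \<le> (\<integral>x. 1 + f x \<partial>neg_variation M \<mu>)"
    using bound by (force intro: Bochner_Integration.integral_nonneg simp: abs_le_iff)+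
  then have "(\<integral>x. 1 - f x \<partial>pos_variation M \<mu>) = 0" "(\<integral>x. 1 + f x \<partial>neg_variation M \<mu>) = 0"
    using tv_norm_diff_signed_integral[OF \<mu> f bound] eq by linarith+
  then have "measure (pos_variation M \<mu>) A = 0" "measure (neg_variation M \<mu>) A = 0"
    using f bound A(2) fin
    by (intro null[of _ "\<lambda>x. 1 - f x"] null[of _ "\<lambda>x. 1 + f x"]; force simp: abs_le_iff abs_less_iff)+
  then show ?thesis
    using Jordan[OF A(1)] signed_measure_split[OF \<mu> A(1) P] by simp
qed

section \<open>Linearity of the integral and finitely supported measures\<close>

lemma signed_integral_cong:
  assumes "\<And>x. x \<in> space M \<Longrightarrow> f x = g x"
  shows "signed_integral M \<mu> f = signed_integral M \<mu> g"
  using assms unfolding signed_integral_def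
  by (intro arg_cong2[where f = "(-)"] Bochner_Integration.integral_cong) auto

lemma signed_integral_sum:
  assumes \<mu>: "signed_measure M \<mu>" and f: "\<And>j. j \<in> J \<Longrightarrow> f j \<in> borel_measurable M"
    and bound: "\<And>j x. j \<in> J \<Longrightarrow> x \<in> space M \<Longrightarrow> \<bar>f j x\<bar> \<le> B j"
  shows "signed_integral M \<mu> (\<lambda>x. \<Sum>j\<in>J. a j * f j x) = (\<Sum>j\<in>J. a j * signed_integral M \<mu> (f j))"
proof -
  have int: "integrable N (f j)" if "finite_measure N" "sets N = sets M" "j \<in> J" for N j
  proof -
    interpret finite_measure N by fact
    show ?thesis
      using f[OF that(3)] bound[OF that(3)] sets_eq_imp_space_eq[OF that(2)]
      by (intro integrable_const_bound[of _ "B j"])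
        (auto simp: measurable_cong_sets[OF that(2) refl])
  qed
  have fin: "finite_measure (pos_variation M \<mu>)" "finite_measure (neg_variation M \<mu>)"
    using signed_measure_Jordan[OF \<mu>] by blast+
  show ?thesis
    using int[OF fin(1)] int[OF fin(2)]
    by (simp add: signed_integral_def Bochner_Integration.integral_sum sum_subtractf right_diff_distrib)
qed

text \<open>Off the null set \<open>space N - S\<close>, the function \<open>f\<close> agrees with a
  combination of indicators of the points of \<open>S\<close>.\<close>

lemma integral_finite_support:
  fixes f :: "'a \<Rightarrow> real"
  assumes "finite_measure N" and S: "finite S" "\<And>s. s \<in> S \<Longrightarrow> {s} \<in> sets N"
    and null: "measure N (space N - S) = 0" and f: "f \<in> borel_measurable N"
  shows "(\<integral>x. f x \<partial>N) = (\<Sum>s\<in>S. f s * measure N {s})"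
proof -
  interpret finite_measure N by fact
  have "S \<in> sets N" using sets.finite_UN[OF S(1), of "\<lambda>s. {s}"] S(2) by simp
  then have "space N - S \<in> null_sets N"
    using null by (simp add: null_sets_def emeasure_eq_measure)
  then have "AE x in N. x \<notin> space N - S" using AE_not_in by blast
  then have "AE x in N. f x = (\<Sum>s\<in>S. f s * indicator {s} x)"
    by (rule AE_mp) (auto intro!: AE_I2 simp: indicator_def S(1) if_distrib sum.delta cong: if_cong)
  then have "(\<integral>x. f x \<partial>N) = (\<integral>x. (\<Sum>s\<in>S. f s * indicator {s} x) \<partial>N)"
    using f S(2) by (intro integral_cong_AE) auto
  also have "\<dots> = (\<Sum>s\<in>S. f s * measure N {s})"
  proof -
    have "integrable N (indicator {s} :: _ \<Rightarrow> real)" if "s \<in> S" for s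
      using S(2)[OF that] by (simp add: integrable_indicator_iff emeasure_eq_measure)
    then show ?thesis
      using S(2) by (subst Bochner_Integration.integral_sum) (auto intro!: sum.cong)
  qed
  finally show ?thesis .
qed

text \<open>Every measurable set off \<open>S\<close> is tested, because for a signed measure the
  value 0 on the complement alone could come from cancellation.\<close>

definition supported_on :: "'a measure \<Rightarrow> ('a set \<Rightarrow> real) \<Rightarrow> 'a set \<Rightarrow> bool" where
  "supported_on M \<mu> S \<longleftrightarrow> (\<forall>A\<in>sets M. A \<inter> S = {} \<longrightarrow> \<mu> A = 0)"

lemma signed_integral_finite_support:
  assumes \<mu>: "signed_measure M \<mu>" and S: "finite S" "\<And>s. s \<in> S \<Longrightarrow> {s} \<in> sets M"
    and supp: "supported_on M \<mu> S" and f: "f \<in> borel_measurable M"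
  shows "signed_integral M \<mu> f = (\<Sum>s\<in>S. f s * \<mu> {s})"
proof -
  obtain P where P: "P \<in> sets M"
    and fin: "finite_measure (pos_variation M \<mu>)" "finite_measure (neg_variation M \<mu>)"
    and Jordan: "\<And>A. A \<in> sets M \<Longrightarrow> measure (pos_variation M \<mu>) A = \<mu> (A \<inter> P)"
      "\<And>A. A \<in> sets M \<Longrightarrow> measure (neg_variation M \<mu>) A = - \<mu> (A - P)"
    by (rule signed_measure_Jordan[OF \<mu>]) (rule that)
  have "S \<in> sets M" using sets.finite_UN[OF S(1), of "\<lambda>s. {s}"] S(2) by simp
  then have compl: "space M - S \<in> sets M" by auto
  have zero: "\<mu> A = 0" if "A \<in> sets M" "A \<inter> S = {}" for A
    using supp that by (simp add: supported_on_def)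
  \<comment> \<open>Up to sign, both quantities are values of \<open>\<mu>\<close> on measurable
    sets that miss \<open>S\<close>.\<close>
  have "measure (pos_variation M \<mu>) (space M - S) = 0" "measure (neg_variation M \<mu>) (space M - S) = 0"
    unfolding Jordan[OF compl] using compl P by (auto intro!: zero)
  then have "signed_integral M \<mu> f = (\<Sum>s\<in>S. f s * measure (pos_variation M \<mu>) {s})
      - (\<Sum>s\<in>S. f s * measure (neg_variation M \<mu>) {s})"
    unfolding signed_integral_def using fin S f
    by (subst (1 2) integral_finite_support[of _ S])
      (auto simp: measurable_cong_sets[OF sets_variation(1) refl] measurable_cong_sets[OF sets_variation(2) refl])
  also have "\<dots> = (\<Sum>s\<in>S. f s * \<mu> {s})"
    unfolding sum_subtractf[symmetric]
  proof (rule sum.cong)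
    fix s assume "s \<in> S"
    then show "f s * measure (pos_variation M \<mu>) {s} - f s * measure (neg_variation M \<mu>) {s} = f s * \<mu> {s}"
      using Jordan[OF S(2)] signed_measure_split[OF \<mu> S(2) P]
      by (simp add: right_diff_distrib[symmetric] distrib_left)
  qed simp
  finally show ?thesis .
qed

lemma signed_measure_finite_support:
  assumes \<mu>: "signed_measure M \<mu>" and S: "finite S" "\<And>s. s \<in> S \<Longrightarrow> {s} \<in> sets M"
    and supp: "supported_on M \<mu> S" and A: "A \<in> sets M"
  shows "\<mu> A = (\<Sum>s\<in>A \<inter> S. \<mu> {s})"
proof -
  have "S \<in> sets M" using sets.finite_UN[OF S(1), of "\<lambda>s. {s}"] S(2) by simp
  then have "\<mu> A = \<mu> (A \<inter> S) + \<mu> (A - S)" "\<mu> (A - S) = 0"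
    using signed_measure_split[OF \<mu> A] supp A by (auto simp: supported_on_def)
  moreover have "\<mu> (\<Union>((\<lambda>s. {s}) ` (A \<inter> S))) = (\<Sum>B\<in>(\<lambda>s. {s}) ` (A \<inter> S). \<mu> B)"
    using S by (intro signed_measure_Union[OF \<mu>]) (auto simp: disjoint_def)
  ultimately show ?thesis by (simp add: sum.reindex)
qed

lemma signed_measure_linear_combination:
  fixes M :: "'a measure"
  assumes "\<And>i. i \<in> I \<Longrightarrow> signed_measure M (\<mu> i)"
  shows "signed_measure M (\<lambda>A. \<Sum>i\<in>I. a i * \<mu> i A)"
  unfolding signed_measure_def
proof (intro conjI allI impI)
  fix A :: "nat \<Rightarrow> 'a set" assume "range A \<subseteq> sets M" "disjoint_family A"
  then show "(\<lambda>n. \<Sum>i\<in>I. a i * \<mu> i (A n)) sums (\<Sum>i\<in>I. a i * \<mu> i (\<Union>n. A n))"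
    by (intro sums_sum sums_mult signed_measure_sums[OF assms])
qed (use assms in \<open>auto simp: signed_measure_def intro!: sum.neutral\<close>)

section \<open>Measures on the sphere, the operator \<open>K\<close> and its adjoint\<close>

lemma space_sphere_borel [simp]: "space sphere_borel = sphere 0 1"
  by (simp add: sphere_borel_def space_restrict_space)

lemma sets_sphere_borel_iff: "A \<in> sets sphere_borel \<longleftrightarrow> A \<subseteq> sphere 0 1 \<and> A \<in> sets borel"
  unfolding sphere_borel_def by (subst sets_restrict_space_iff) auto

lemma singleton_in_sets_sphere_borel: "w \<in> sphere 0 1 \<Longrightarrow> {w} \<in> sets sphere_borel"
  by (simp add: sets_sphere_borel_iff)

lemma continuous_on_sphere_borel:
  "continuous_on (sphere 0 1) f \<Longrightarrow> f \<in> borel_measurable sphere_borel"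
  unfolding sphere_borel_def by (rule borel_measurable_continuous_on_restrict)

lemma signed_measure_dirac: "signed_measure sphere_borel (dirac w)"
  unfolding signed_measure_def
proof (intro conjI allI impI)
  fix A :: "nat \<Rightarrow> (real^'a) set"
  assume A: "range A \<subseteq> sets sphere_borel" "disjoint_family A"
  show "(\<lambda>i. dirac w (A i)) sums dirac w (\<Union>i. A i)"
  proof (cases "w \<in> (\<Union>i. A i)")
    case True
    then obtain k where k: "w \<in> A k" by blast
    then have "dirac w (A i) = (if i = k then 1 else 0)" for i
      using A by (auto simp: dirac_def disjoint_family_on_def)
    moreover have "dirac w (\<Union>i. A i) = 1"
      using True A(1) by (auto simp: dirac_def)
    ultimately show ?thesis using sums_single[of k "\<lambda>_. 1 :: real"] by simp
  next
    case False
    then show ?thesis by (simp add: dirac_def)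
  qed
qed (auto simp: dirac_def)

text \<open>The finite set \<open>A \<inter> S\<close> is a compact subset of \<open>A\<close> that
  leaves a remainder of total variation 0.\<close>

lemma radon_measure_finite_support:
  assumes \<mu>: "signed_measure sphere_borel \<mu>" and S: "finite S" "S \<subseteq> sphere 0 1"
    and supp: "supported_on sphere_borel \<mu> S"
  shows "\<mu> \<in> radon_measures"
proof -
  obtain P where P: "P \<in> sets sphere_borel" and tv: "\<And>A. A \<in> sets sphere_borel \<Longrightarrow>
      measure (total_variation sphere_borel \<mu>) A = \<mu> (A \<inter> P) - \<mu> (A - P)"
    by (rule signed_measure_Jordan[OF \<mu>]) (rule that)
  have "\<exists>C\<subseteq>A. compact C \<and> measure (total_variation sphere_borel \<mu>) (A - C) < e"
    if A: "A \<in> sets sphere_borel" and "e > 0" for A and e :: real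
  proof (intro exI conjI)
    show "compact (A \<inter> S)" using S by (simp add: finite_imp_compact)
    have "S \<in> sets sphere_borel"
      using S by (simp add: sets_sphere_borel_iff finite_imp_closed)
    then have sets: "A - A \<inter> S \<in> sets sphere_borel" using A by blast
    have zero: "\<mu> B = 0" if "B \<in> sets sphere_borel" "B \<inter> S = {}" for B
      using supp that by (simp add: supported_on_def)
    have "\<mu> ((A - A \<inter> S) \<inter> P) = 0" "\<mu> (A - A \<inter> S - P) = 0"
      by (rule zero; use sets P in blast)+
    then show "measure (total_variation sphere_borel \<mu>) (A - A \<inter> S) < e"
      unfolding tv[OF sets] using \<open>e > 0\<close> by simp
  qed auto
  then show ?thesis using \<mu> by (simp add: radon_measures_def)
qed

lemma continuous_on_relu_inner: "continuous_on A (\<lambda>w. relu (w \<bullet> v))"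
  unfolding relu_def by (intro continuous_intros)

lemma signed_integral_dirac:
  assumes "w \<in> sphere 0 1" "f \<in> borel_measurable sphere_borel"
  shows "signed_integral sphere_borel (dirac w) f = f w"
  using assms singleton_in_sets_sphere_borel[OF assms(1)]
  by (subst signed_integral_finite_support[OF signed_measure_dirac, of "{w}"])
    (auto simp: supported_on_def dirac_def)

text \<open>Turns an equation between images under \<open>K x\<close> into a linear relation among
  the vectors \<open>K x (dirac s)\<close>, to which linear independence can be applied.\<close>

lemma K_finite_support:
  assumes \<mu>: "signed_measure sphere_borel \<mu>" and S: "finite S" "S \<subseteq> sphere 0 1"
    and supp: "supported_on sphere_borel \<mu> S"
  shows "K x \<mu> = (\<Sum>s\<in>S. \<mu> {s} *\<^sub>R K x (dirac s))"
proof -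
  have meas: "(\<lambda>w. relu (w \<bullet> x j)) \<in> borel_measurable sphere_borel" for j
    by (intro continuous_on_sphere_borel continuous_on_relu_inner)
  have "K x \<mu> $ j = (\<Sum>s\<in>S. \<mu> {s} *\<^sub>R K x (dirac s)) $ j" for j
  proof -
    have "K x \<mu> $ j = (\<Sum>s\<in>S. relu (s \<bullet> x j) * \<mu> {s})"
      using S by (auto simp: K_def intro!: signed_integral_finite_support[OF \<mu> _ _ supp meas]
          singleton_in_sets_sphere_borel)
    also have "\<dots> = (\<Sum>s\<in>S. \<mu> {s} *\<^sub>R K x (dirac s)) $ j"
      using S(2) by (auto simp: K_def signed_integral_dirac[OF _ meas] mult.commute intro!: sum.cong)
    finally show ?thesis .
  qed
  then show ?thesis by (simp add: vec_eq_iff)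
qed

text \<open>Adjointness of \<open>K\<close> and \<open>K_star\<close>: the finite sum is integrated
  term by term, each term being bounded on the sphere by Cauchy-Schwarz.\<close>

lemma signed_integral_K_star:
  assumes \<mu>: "signed_measure sphere_borel \<mu>"
  shows "signed_integral sphere_borel \<mu> (K_star x p) = p \<bullet> K x \<mu>"
proof -
  have "\<bar>relu (w \<bullet> x j)\<bar> \<le> norm (x j)" if "w \<in> sphere 0 1" for w j
    using that Cauchy_Schwarz_ineq2[of w "x j"] by (auto simp: relu_def)
  then have "signed_integral sphere_borel \<mu> (\<lambda>w. \<Sum>j\<in>UNIV. p $ j * relu (w \<bullet> x j))
      = (\<Sum>j\<in>UNIV. p $ j * signed_integral sphere_borel \<mu> (\<lambda>w. relu (w \<bullet> x j)))"
    by (intro signed_integral_sum[OF \<mu>, where B = "\<lambda>j. norm (x j)"]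
        continuous_on_sphere_borel continuous_on_relu_inner) auto
  then show ?thesis by (simp add: K_star_def[abs_def] K_def inner_vec_def)
qed

text \<open>Compactness of the sphere bounds the set of values, so that the real supremum in
  \<open>sup_norm\<close> is a genuine upper bound.\<close>

lemma abs_le_sup_norm:
  assumes "continuous_on (sphere 0 1) f" "v \<in> sphere 0 1"
  shows "\<bar>f v\<bar> \<le> sup_norm f"
proof -
  have "compact ((\<lambda>w. \<bar>f w\<bar>) ` sphere 0 1)"
    using assms(1) by (intro compact_continuous_image continuous_intros) auto
  then have "bdd_above ((\<lambda>w. \<bar>f w\<bar>) ` sphere 0 1)"
    by (intro bounded_imp_bdd_above compact_imp_bounded)
  then show ?thesis unfolding sup_norm_def using assms(2) by (intro cSUP_upper)
qed

section \<open>Optimality and uniqueness\<close>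

text \<open>The square is expanded around the residual \<open>K x \<mu> - y\<close>, which is
  \<open>p\<close> scaled by \<open>- lam\<close>. By adjointness the cross term is
  \<open>- lam\<close> times the difference of the integrals of \<open>\<eta>\<close> against
  \<open>\<nu>\<close> and \<open>\<mu>\<close>. The integral against \<open>\<mu>\<close> equals
  the norm of \<open>\<mu>\<close> and cancels the regularizer there.\<close>

lemma objective_diff_dual_certificate:
  assumes lam: "lam > 0" and \<mu>: "signed_measure sphere_borel \<mu>" and \<nu>: "signed_measure sphere_borel \<nu>"
    and dual: "dual_certificate x lam y \<mu> \<eta>"
  shows "objective x lam y \<nu> - objective x lam y \<mu> =
    lam * (tv_norm sphere_borel \<nu> - signed_integral sphere_borel \<nu> \<eta>) + 1 / 2 * (norm (K x \<nu> - K x \<mu>))\<^sup>2"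
proof -
  define p where "p = - (1 / lam) *\<^sub>R (K x \<mu> - y)"
  have p: "K x \<mu> - y = - lam *\<^sub>R p" using lam by (simp add: p_def)
  have pair: "signed_integral sphere_borel \<rho> \<eta> = p \<bullet> K x \<rho>" if "signed_measure sphere_borel \<rho>" for \<rho>
    unfolding signed_integral_K_star[OF that, symmetric]
    by (rule signed_integral_cong) (use dual in \<open>simp add: dual_certificate_def p_def\<close>)
  have tv: "tv_norm sphere_borel \<mu> = p \<bullet> K x \<mu>"
    using dual pair[OF \<mu>] by (simp add: dual_certificate_def tv_subdifferential_def)
  have "K x \<nu> - y = (K x \<nu> - K x \<mu>) + (K x \<mu> - y)" by simp
  then have "(norm (K x \<nu> - y))\<^sup>2 = (norm (K x \<nu> - K x \<mu>))\<^sup>2 + (norm (K x \<mu> - y))\<^sup>2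
      + 2 * ((K x \<nu> - K x \<mu>) \<bullet> (K x \<mu> - y))"
    by (simp only: power2_norm_eq_inner inner_add_left inner_add_right)
      (simp add: inner_commute)
  also have "(K x \<nu> - K x \<mu>) \<bullet> (K x \<mu> - y) = - lam * (p \<bullet> K x \<nu> - p \<bullet> K x \<mu>)"
    unfolding p by (simp add: inner_diff_right inner_commute[of _ p])
  finally show ?thesis
    unfolding objective_def pair[OF \<nu>] tv by (simp add: algebra_simps)
qed

text \<open>Independence concerns a set of vectors, so the coefficients are carried from indices to
  vectors by \<open>inv_into S g\<close>; injectivity keeps two indices from sharing a
  vector.\<close>

lemma independent_image_coeffs_eq_0:
  fixes g :: "'a \<Rightarrow> 'b::real_vector"
  assumes "independent (g ` S)" "inj_on g S" "finite S"
    and "(\<Sum>s\<in>S. a s *\<^sub>R g s) = 0" "s \<in> S"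
  shows "a s = 0"
proof -
  have "(\<Sum>v\<in>g ` S. a (inv_into S g v) *\<^sub>R v) = 0"
    using assms by (simp add: sum.reindex)
  then have "a (inv_into S g (g s)) = 0"
    using assms by (intro independentD[OF assms(1)]) auto
  then show ?thesis using assms by simp
qed

theorem theorem3p19:
  fixes x :: "'n::finite \<Rightarrow> real^'d"
    and lam :: real
    and y0 \<zeta> :: "real^'n"
    and N :: nat
    and c \<sigma> :: "nat \<Rightarrow> real"
    and w :: "nat \<Rightarrow> real^'d"
    and \<pi> :: "nat \<Rightarrow> 'n \<Rightarrow> bool"
    and \<mu> :: "(real^'d) set \<Rightarrow> real"
    and \<eta> :: "real^'d \<Rightarrow> real"
  assumes "\<And>j. x j \<noteq> 0"
    and "lam > 0"
    and "\<mu> = (\<lambda>A. \<Sum>i=1..N. c i * \<sigma> i * dirac (w i) A)"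
    and "\<And>i. i \<in> {1..N} \<Longrightarrow> c i > 0"
    and "\<And>i. i \<in> {1..N} \<Longrightarrow> \<sigma> i \<in> {-1, 1}"
    and "\<And>i. i \<in> {1..N} \<Longrightarrow> w i \<in> closure (region x (\<pi> i)) \<inter> sphere 0 1"
    and "dual_certificate x lam (y0 + \<zeta>) \<mu> \<eta>"
    and "inj_on (\<lambda>i. K x (dirac (w i))) {1..N}"
    and "independent ((\<lambda>i. K x (dirac (w i))) ` {1..N})"
    and "\<And>v. v \<in> sphere 0 1 - w ` {1..N} \<Longrightarrow> \<bar>\<eta> v\<bar> < 1"
  shows "training_solution x lam (y0 + \<zeta>) \<mu> \<and>
         (\<forall>\<nu>. training_solution x lam (y0 + \<zeta>) \<nu> \<longrightarrow> \<nu> = \<mu>)"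
proof -
  \<comment> \<open>Measures are compared through their values on the singletons of \<open>S\<close>
    rather than through indexed weights.\<close>
  define S where "S = w ` {1..N}"
  have S: "finite S" "S \<subseteq> sphere 0 1"
    using assms(6) by (auto simp: S_def)
  have sing: "{s} \<in> sets sphere_borel" if "s \<in> S" for s
    using S that by (intro singleton_in_sets_sphere_borel) auto
  have \<mu>: "signed_measure sphere_borel \<mu>"
    unfolding assms(3) by (intro signed_measure_linear_combination signed_measure_dirac)
  have \<mu>_supp: "supported_on sphere_borel \<mu> S"
    unfolding supported_on_def assms(3)
  proof (intro ballI impI sum.neutral)
    fix A i assume "A \<inter> S = {}" "i \<in> {1..N}"
    then have "w i \<notin> A" by (auto simp: S_def)
    then show "c i * \<sigma> i * dirac (w i) A = 0" by (simp add: dirac_def)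
  qed
  have \<eta>_cont: "continuous_on (sphere 0 1) \<eta>" and "sup_norm \<eta> \<le> 1"
    using assms(7) by (auto simp: dual_certificate_def tv_subdifferential_def)
  then have \<eta>_le: "\<bar>\<eta> v\<bar> \<le> 1" if "v \<in> space sphere_borel" for v
    using abs_le_sup_norm[OF \<eta>_cont, of v] that by simp
  note \<eta>_meas = continuous_on_sphere_borel[OF \<eta>_cont]
  note diff = objective_diff_dual_certificate[OF assms(2) \<mu> _ assms(7)]
  have gap: "0 \<le> lam * (tv_norm sphere_borel \<nu> - signed_integral sphere_borel \<nu> \<eta>)"
    if "signed_measure sphere_borel \<nu>" for \<nu>
    using signed_integral_le_tv_norm[OF that \<eta>_meas \<eta>_le] assms(2) by simp
  have min: "objective x lam (y0 + \<zeta>) \<mu> \<le> objective x lam (y0 + \<zeta>) \<nu>" if "\<nu> \<in> radon_measures" for \<nu>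
  proof -
    have \<nu>: "signed_measure sphere_borel \<nu>" using that by (simp add: radon_measures_def)
    have "0 \<le> 1 / 2 * (norm (K x \<nu> - K x \<mu>))\<^sup>2" by simp
    then show ?thesis using diff[OF \<nu>] gap[OF \<nu>] by linarith
  qed
  have \<mu>_radon: "\<mu> \<in> radon_measures"
    using radon_measure_finite_support[OF \<mu> S \<mu>_supp] .
  have "\<nu> = \<mu>" if sol: "training_solution x lam (y0 + \<zeta>) \<nu>" for \<nu>
  proof -
    have \<nu>: "signed_measure sphere_borel \<nu>"
      using sol by (simp add: training_solution_def radon_measures_def)
    have "objective x lam (y0 + \<zeta>) \<nu> \<le> objective x lam (y0 + \<zeta>) \<mu>"
      using sol \<mu>_radon by (simp add: training_solution_def)
    moreover have "0 \<le> 1 / 2 * (norm (K x \<nu> - K x \<mu>))\<^sup>2" by simp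
    \<comment> \<open>The difference of the objectives is at most 0 and is a sum of two nonnegative
      terms, so each of them is 0.\<close>
    ultimately have "lam * (tv_norm sphere_borel \<nu> - signed_integral sphere_borel \<nu> \<eta>) = 0"
      and "1 / 2 * (norm (K x \<nu> - K x \<mu>))\<^sup>2 = 0"
      using diff[OF \<nu>] gap[OF \<nu>] by linarith+
    then have norming: "signed_integral sphere_borel \<nu> \<eta> = tv_norm sphere_borel \<nu>" and K_eq: "K x \<nu> = K x \<mu>"
      using assms(2) by simp_all
    have \<nu>_supp: "supported_on sphere_borel \<nu> S"
      unfolding supported_on_def
    proof (intro ballI impI)
      fix A assume A: "A \<in> sets sphere_borel" "A \<inter> S = {}"
      \<comment> \<open>Measurable sets lie in the sphere, so each point of \<open>A\<close> is a
        point of the sphere other than the atoms.\<close>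
      then have "\<bar>\<eta> v\<bar> < 1" if "v \<in> A" for v
        using that sets.sets_into_space[OF A(1)] by (intro assms(10)) (auto simp: S_def)
      then show "\<nu> A = 0"
        using signed_measure_eq_0_if_norming[OF \<nu> \<eta>_meas \<eta>_le norming A(1)] by blast
    qed
    \<comment> \<open>Both measures are supported on \<open>S\<close>, so \<open>K_eq\<close> is a
      relation between their point values.\<close>
    have "(\<Sum>s\<in>S. (\<nu> {s} - \<mu> {s}) *\<^sub>R K x (dirac s)) = 0"
      using K_eq
      by (simp add: scaleR_diff_left sum_subtractf
          flip: K_finite_support[OF \<nu> S \<nu>_supp] K_finite_support[OF \<mu> S \<mu>_supp])
    \<comment> \<open>Injectivity in the index \<open>i\<close> passes to the points
      \<open>w i\<close>.\<close>
    moreover have "inj_on (\<lambda>s. K x (dirac s)) S"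
      unfolding S_def by (rule inj_on_imageI) (use assms(8) in \<open>simp add: comp_def\<close>)
    moreover have "independent ((\<lambda>s. K x (dirac s)) ` S)"
      using assms(9) by (simp add: S_def image_image)
    ultimately have atoms: "\<nu> {s} = \<mu> {s}" if "s \<in> S" for s
      using independent_image_coeffs_eq_0[of "\<lambda>s. K x (dirac s)" S "\<lambda>s. \<nu> {s} - \<mu> {s}" s] S(1) that
      by simp
    show "\<nu> = \<mu>"
    proof
      fix A
      show "\<nu> A = \<mu> A"
      proof (cases "A \<in> sets sphere_borel")
        case True
        then show ?thesis
          using signed_measure_finite_support[OF \<nu> S(1) sing \<nu>_supp]
            signed_measure_finite_support[OF \<mu> S(1) sing \<mu>_supp] atoms by simp
      next
        case False
        \<comment> \<open>Outside the sigma-algebra both set functions take the default value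
          0.\<close>
        then show ?thesis using \<mu> \<nu> by (simp add: signed_measure_def)
      qed
    qed
  qed
  then show ?thesis using min \<mu>_radon by (simp add: training_solution_def)
qed

end
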